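(* Let $q$ be a prime power and let $m,n,d$ be integers with $m \ge n \ge 2$ and $2 \le d \le n$. Let $k=m(n-d+1)$. Then $$\delta_q(n \times m, k,d) \le 1- \frac{\binom{n}{d-1}_q^2 \, \nu_q(mn,k,m(d-1))^2 }{\binom{mn}{k}_q \, \sum_{i=0}^{d-1} \nu_q(mn,k,mi) \, \theta_q(n,d-1,i)}.$$
   Context: The $q$-binomial coefficient is $\binom{a}{b}_q = \prod_{i=0}^{b-1} \frac{q^a-q^i}{q^b-q^i}$ for integers $a \ge b \ge 0$. A (rank-metric) code is a non-zero $\mathbb{F}_q$-linear subspace $\mathcal{C}$ of the space $\mathbb{F}_q^{n\times m}$ of $n \times m$ matrices; its minimum distance is $d(\mathcal{C})=\min\{\mathrm{rk}(M) \mid M \in \mathcal{C}, M\ne 0\}$. For $1\le k\le mn$ and $1 \le d \le n$, $$\delta_q(n \times m, k, d):= \frac{|\{\mathcal{C} \le \mathbb{F}_q^{n\times m} \mid \dim(\mathcal{C})=k, \; d(\mathcal{C}) \ge d\}|}{\binom{mn}{k}_q}.$$ For non-negative integers $N,k,\ell$ with $N \ge 3$, $k<N$, $N-2k \le \ell \le N-k$, $$\nu_q(N,k,\ell) := \binom{N}{k}_q - 2q^{k(N-k)} + q^{(2k-N+\ell)(N-k)}\prod_{i=\ell}^{N-k-1}(q^{N-k}-q^i)$$ (empty products equal $1$). $\theta_q(n,u,i)$ denotes the number of pairs $(U,U')$ of $u$-dimensional subspaces $U,U' \le \mathbb{F}_q^n$ with $\dim(U \cap U')=i$; it is $0$ if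 $i<2u-n$, so terms of the sum with $i<2(d-1)-n$ are zero. *)

theory Defs
  imports "HOL-Analysis.Analysis"
begin

text \<open>
  The field with \<open>q\<close> elements is a type \<open>'a :: {field, finite}\<close> with \<open>CARD('a) = q\<close>, and the
  \<open>n \<times> m\<close> matrices over it form the type \<open>'a^'m^'n\<close> with \<open>CARD('n) = n\<close> rows and
  \<open>CARD('m) = m\<close> columns.
\<close>

definition qbinom :: "nat \<Rightarrow> nat \<Rightarrow> nat \<Rightarrow> real"
  where "qbinom q a b = (\<Prod>i<b. (real q ^ a - real q ^ i) / (real q ^ b - real q ^ i))"

text \<open>
  The library's scalar multiplication \<open>*s\<close>, used at type \<open>'a^'m^'n\<close>, takes its scalars from
  \<open>'a^'m\<close>; scaling a matrix by an element of the field \<open>'a\<close> is a different operation.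
\<close>

definition mscale :: "'a::field \<Rightarrow> 'a^'m^'n \<Rightarrow> 'a^'m^'n"
  where "mscale c A = (\<chi> i j. c * A $ i $ j)"

interpretation mat: vector_space "mscale :: 'a::field \<Rightarrow> 'a^'m^'n \<Rightarrow> 'a^'m^'n"
  by unfold_locales (simp_all add: mscale_def vec_eq_iff algebra_simps)

definition rank_metric_code :: "('a::field^'m^'n) set \<Rightarrow> bool"
  where "rank_metric_code C \<longleftrightarrow> mat.subspace C \<and> C \<noteq> {0}"

definition min_dist :: "('a::{field,finite}^'m^'n) set \<Rightarrow> nat"
  where "min_dist C = Min {rank M | M. M \<in> C \<and> M \<noteq> 0}"

definition delta ::
    "'a::{field,finite} itself \<Rightarrow> 'n::finite itself \<Rightarrow> 'm::finite itself \<Rightarrow> nat \<Rightarrow> nat \<Rightarrow> real"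
  where "delta TA TN TM k d =
    real (card {C :: ('a^'m^'n) set. rank_metric_code C \<and> mat.dim C = k \<and> min_dist C \<ge> d})
      / qbinom CARD('a) (CARD('m) * CARD('n)) k"

text \<open>
  For \<open>l < N - 2 * k\<close>, where \<open>nu\<close> has no meaning, the exponent \<open>2 * k - N + l\<close> is negative;
  it is computed in the integers.
\<close>

definition nu :: "nat \<Rightarrow> nat \<Rightarrow> nat \<Rightarrow> nat \<Rightarrow> real"
  where "nu q N k l =
    qbinom q N k - 2 * real q ^ (k * (N - k))
      + real q powi ((2 * int k - int N + int l) * (int N - int k))
        * (\<Prod>i\<in>{l..<N - k}. real q ^ (N - k) - real q ^ i)"

definition theta :: "'a::{field,finite} itself \<Rightarrow> 'n::finite itself \<Rightarrow> nat \<Rightarrow> nat \<Rightarrow> nat"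
  where "theta TA TN u i =
    card {(U :: ('a^'n) set, U' :: ('a^'n) set).
      vec.subspace U \<and> vec.subspace U' \<and> vec.dim U = u \<and> vec.dim U' = u \<and> vec.dim (U \<inter> U') = i}"

end

theory Submission
  imports Defs
begin

text \<open>
  Let \<open>u = d - 1\<close> and \<open>N = m n\<close>. For a \<open>u\<close>-dimensional subspace \<open>U\<close> of the column space \<open>F\<^sup>n\<close>, let
  \<open>A(U)\<close> be the space of matrices all of whose columns lie in \<open>U\<close>; it has dimension \<open>m u = N - k\<close>. A
  matrix has rank at most \<open>u\<close> iff it lies in some \<open>A(U)\<close>, so a \<open>k\<close>-dimensional code has minimum
  distance at least \<open>d\<close> iff it meets every \<open>A(U)\<close> trivially. With \<open>B(U)\<close> the set of \<open>k\<close>-dimensional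
  codes that meet \<open>A(U)\<close> nontrivially, the codes to be counted are those outside the union of the
  sets \<open>B(U)\<close>, and the Cauchy-Schwarz inequality bounds this union from below:
  \<open>(\<Sum>\<^sub>U |B(U)|)\<^sup>2 \<le> |\<Union>\<^sub>U B(U)| \<cdot> \<Sum>\<^sub>U \<Sum>\<^sub>U\<^sub>' |B(U) \<inter> B(U')|\<close>.

  It remains to compute \<open>|B(U) \<inter> B(U')|\<close>, the case \<open>U = U'\<close> giving \<open>|B(U)|\<close>. Inclusion-exclusion
  reduces this to the number of \<open>k\<close>-dimensional subspaces and to the number of common complements of
  two subspaces \<open>W, W'\<close> of dimension \<open>w = N - k\<close> with intersection of dimension \<open>l\<close>. For the latter,
  fix a basis \<open>p\<^sub>1, \<dots>, p\<^sub>k\<close> of a complement of \<open>W'\<close>, starting with vectors outside \<open>W + W'\<close> and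
  ending with \<open>w - l\<close> vectors of \<open>W\<close>. Every complement of \<open>W'\<close> has a unique basis of the form
  \<open>p\<^sub>i + y\<^sub>i\<close> with \<open>y\<^sub>i \<in> W'\<close>, and it is a complement of \<open>W\<close> too iff the vectors \<open>p\<^sub>i + y\<^sub>i\<close> are
  independent modulo \<open>W\<close>. The \<open>y\<^sub>i\<close> belonging to the vectors \<open>p\<^sub>i\<close> outside \<open>W + W'\<close> are then free,
  while those belonging to vectors of \<open>W\<close> must themselves be independent modulo \<open>W\<close>. This gives
  \<open>q\<^bsup>w(k + l - w)\<^esup> \<cdot> \<Prod>\<^bsub>l \<le> i < w\<^esub> (q\<^sup>w - q\<^sup>i)\<close> common complements, so that
  \<open>|B(U) \<inter> B(U')| = \<nu>(N, k, m dim (U \<inter> U'))\<close>; grouping the pairs by \<open>dim (U \<inter> U')\<close> produces the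
  numbers \<open>\<theta>\<close>.
\<close>

section \<open>Cardinalities of subspaces\<close>

lemma card_field_ge_2: "2 \<le> CARD('a::{field,finite})"
proof -
  have "card {0, 1 :: 'a} \<le> CARD('a)" by (intro card_mono) auto
  then show ?thesis by simp
qed

text \<open>
  A vector space with finitely many vectors over a finite field; finiteness is a property of the
  types.
\<close>

locale finite_vector_space = vector_space scale
  for scale :: "'a::{field,finite} \<Rightarrow> 'b::{ab_group_add,finite} \<Rightarrow> 'b"
begin

sublocale finite_dimensional_vector_space scale "extend_basis {}"
  by unfold_locales (simp_all add: independent_extend_basis independent_empty)

lemma card_span_independent:
  assumes "finite B" "independent B"
  shows "card (span B) = CARD('a) ^ card B"
  using assms
proof (induction B rule: finite_induct)
  case empty
  then show ?case by simp
next
  case (insert b B)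
  then have b: "b \<notin> span B" and B: "independent B"
    by (simp_all add: independent_insert)
  define f where "f = (\<lambda>(c, x). scale c b + x)"
  have "span (insert b B) = f ` (UNIV \<times> span B)"
  proof (intro set_eqI iffI)
    fix x assume "x \<in> span (insert b B)"
    then obtain c where "x - scale c b \<in> span B"
      by (auto simp: span_insert)
    then show "x \<in> f ` (UNIV \<times> span B)"
      by (intro image_eqI[of _ _ "(c, x - scale c b)"]) (auto simp: f_def)
  next
    fix x assume "x \<in> f ` (UNIV \<times> span B)"
    then obtain c y where "x = scale c b + y" "y \<in> span B"
      by (auto simp: f_def)
    then show "x \<in> span (insert b B)"
      by (auto simp: span_insert intro!: exI[of _ c])
  qed
  moreover have "inj_on f (UNIV \<times> span B)"
  proof (rule inj_onI, clarsimp simp: f_def)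
    fix c x c' x' assume x: "x \<in> span B" "x' \<in> span B" and eq: "scale c b + x = scale c' b + x'"
    have *: "scale (c - c') b = x' - x"
      using eq by (simp add: scale_left_diff_distrib algebra_simps)
    have "c = c'"
    proof (rule ccontr)
      assume "c \<noteq> c'"
      then have "b = scale (inverse (c - c')) (x' - x)"
        by (simp flip: *)
      then show False
        using b x by (metis span_diff span_scale)
    qed
    then show "c = c' \<and> x = x'" using eq by simp
  qed
  ultimately have "card (span (insert b B)) = card (UNIV \<times> span B :: ('a \<times> 'b) set)"
    by (simp add: card_image)
  then show ?case
    using insert B by (simp add: card_cartesian_product)
qed

lemma card_subspace:
  assumes "subspace S"
  shows "card S = CARD('a) ^ dim S"
proof -
  obtain B where "B \<subseteq> S" "independent B" "S \<subseteq> span B" "card B = dim S"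
    using basis_exists by blast
  moreover from this have "span B = S"
    using assms by (simp add: span_subspace)
  ultimately show ?thesis
    using card_span_independent[of B] by simp
qed

lemma dim_Un_Int:
  assumes "subspace S" "subspace T"
  shows "dim (S \<union> T) + dim (S \<inter> T) = dim S + dim T"
proof -
  have "span (S \<union> T) = {x + y | x y. x \<in> S \<and> y \<in> T}"
    using assms by (simp add: span_Un span_eq_iff[THEN iffD2])
  then have "dim (S \<union> T) = dim {x + y | x y. x \<in> S \<and> y \<in> T}"
    by (metis dim_span)
  then show ?thesis
    using dim_sums_Int[OF assms] by simp
qed

section \<open>Lists that are independent modulo a subspace\<close>

text \<open>
  The entries of \<open>vs\<close> are distinct and linearly independent in the quotient by the span of \<open>W\<close>. This
  is expressed by dimensions, which avoids forming the quotient.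
\<close>

definition indep_mod :: "'b set \<Rightarrow> 'b list \<Rightarrow> bool"
  where "indep_mod W vs \<longleftrightarrow> dim (W \<union> set vs) = dim W + length vs"

lemma dim_Un_set_le: "dim (W \<union> set vs) \<le> dim W + length vs"
  by (induction vs) (auto simp: dim_insert)

lemma indep_mod_Nil [simp]: "indep_mod W []"
  by (simp add: indep_mod_def)

lemma indep_mod_Cons:
  "indep_mod W (v # vs) \<longleftrightarrow> indep_mod W vs \<and> v \<notin> span (W \<union> set vs)"
  using dim_Un_set_le[of W vs] by (auto simp: indep_mod_def dim_insert)

lemma indep_mod_cong_span:
  assumes "span (W \<union> set vs) = span (W \<union> set vs')" "length vs = length vs'"
  shows "indep_mod W vs \<longleftrightarrow> indep_mod W vs'"
  using assms by (metis indep_mod_def span_eq_dim)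

text \<open>
  A list of length \<open>i\<close> that is independent modulo \<open>W\<close> extends by any vector of \<open>S\<close> outside a subspace
  of \<open>S\<close> of dimension \<open>dim (S \<inter> W) + i\<close>. If \<open>i\<close> reaches \<open>dim S - dim (S \<inter> W)\<close>, the corresponding factor
  vanishes and there is no list.
\<close>

lemma card_indep_mod:
  assumes S: "subspace S" and W: "subspace W"
  shows "real (card {vs. length vs = k \<and> set vs \<subseteq> S \<and> indep_mod W vs})
    = (\<Prod>i<k. real CARD('a) ^ dim S - real CARD('a) ^ (dim (S \<inter> W) + i))"
proof (induction k)
  case 0
  have "{vs. length vs = 0 \<and> set vs \<subseteq> S \<and> indep_mod W vs} = {[]}" by auto
  then show ?case by simp
next
  case (Suc k)
  define L where "L k = {vs. length vs = k \<and> set vs \<subseteq> S \<and> indep_mod W vs}" for k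
  have fin: "finite (L k)"
    by (rule finite_subset[OF _ finite_lists_length_eq[of UNIV k]]) (auto simp: L_def)
  have "L (Suc k) = (\<lambda>(vs, v). v # vs) ` (SIGMA vs:L k. S - span (W \<union> set vs))"
    by (force simp: L_def indep_mod_Cons length_Suc_conv image_iff)
  then have "card (L (Suc k)) = card (SIGMA vs:L k. S - span (W \<union> set vs))"
    by (simp add: card_image inj_on_def)
  also have "\<dots> = (\<Sum>vs\<in>L k. card (S - span (W \<union> set vs)))"
    using fin by simp
  finally have "real (card (L (Suc k))) = (\<Sum>vs\<in>L k. real (card (S - span (W \<union> set vs))))"
    by simp
  also have "\<dots> = (\<Sum>vs\<in>L k. real CARD('a) ^ dim S - real CARD('a) ^ (dim (S \<inter> W) + k))"
  proof (rule sum.cong[OF refl])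
    fix vs assume vs: "vs \<in> L k"
    define T where "T = span (W \<union> set vs)"
    have T: "subspace T" by (simp add: T_def)
    have dT: "dim T = dim W + k"
      using vs by (simp add: T_def L_def indep_mod_def)
    have "span (S \<union> T) = span (S \<union> W)"
      using vs unfolding span_eq T_def
      by (auto simp: L_def intro: span_base in_span_insert span_mono[THEN subsetD, rotated])
    then have "dim (S \<union> T) = dim (S \<union> W)" by (metis dim_span)
    then have dST: "dim (S \<inter> T) = dim (S \<inter> W) + k"
      using dim_Un_Int[OF S T] dim_Un_Int[OF S W] dT by simp
    have "card (S - T) = card S - card (S \<inter> T)"
      by (simp add: card_Diff_subset_Int)
    moreover have "card (S \<inter> T) \<le> card S"
      by (simp add: card_mono)
    ultimately have "real (card (S - T)) = real (card S) - real (card (S \<inter> T))"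
      by simp
    then show "real (card (S - span (W \<union> set vs)))
        = real CARD('a) ^ dim S - real CARD('a) ^ (dim (S \<inter> W) + k)"
      using S T dST by (simp add: card_subspace subspace_inter flip: T_def)
  qed
  also have "\<dots> = real (card (L k)) * (real CARD('a) ^ dim S - real CARD('a) ^ (dim (S \<inter> W) + k))"
    by simp
  finally show ?case
    using Suc by (simp add: L_def mult.commute)
qed

lemma indep_mod_subspaceD:
  assumes "subspace W" "indep_mod W vs"
  shows "dim (set vs) = length vs" "W \<inter> span (set vs) = {0}"
proof -
  have "span (W \<union> span (set vs)) = span (W \<union> set vs)"
    unfolding span_eq
    by (auto intro: span_base span_mono[THEN subsetD, rotated])
  then have "dim (W \<union> span (set vs)) = dim W + length vs"
    using assms by (metis dim_span indep_mod_def)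
  moreover have "dim (set vs) \<le> length vs"
    using dim_le_card'[of "set vs"] card_length[of vs] by simp
  moreover have "dim (W \<union> span (set vs)) + dim (W \<inter> span (set vs)) = dim W + dim (set vs)"
    using dim_Un_Int[OF assms(1) subspace_span[of "set vs"]] by simp
  ultimately have eq: "dim (set vs) = length vs" and "dim (W \<inter> span (set vs)) = 0"
    by linarith+
  then have "W \<inter> span (set vs) \<subseteq> {0}"
    by (simp only: dim_eq_0)
  then show "dim (set vs) = length vs" "W \<inter> span (set vs) = {0}"
    using assms eq by (auto simp: subspace_0 span_zero)
qed

text \<open>
  Double counting of the pairs of a \<open>k\<close>-dimensional subspace and an ordered basis of it.
\<close>

lemma card_subspaces_of_dim:
  "real (card {C. subspace C \<and> dim C = k}) = qbinom CARD('a) (dim (UNIV :: 'b set)) k"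
proof -
  define q where "q = real CARD('a)"
  have q: "q > 1" using card_field_ge_2[where 'a = 'a] by (simp add: q_def)
  define K where "K = {C. subspace C \<and> dim C = k}"
  define L where "L = {vs. length vs = k \<and> set vs \<subseteq> UNIV \<and> indep_mod {0} vs}"
  have fin: "finite L"
    by (rule finite_subset[OF _ finite_lists_length_eq[of UNIV k]]) (auto simp: L_def)
  have dim0: "dim (insert 0 A) = dim A" for A
    by (simp add: dim_insert span_zero)
  have LK: "span (set vs) \<in> K" if "vs \<in> L" for vs
    using that by (simp add: L_def K_def indep_mod_def dim0)
  have fib: "{vs \<in> L. span (set vs) = C} = {vs. length vs = k \<and> set vs \<subseteq> C \<and> indep_mod {0} vs}"
    if "C \<in> K" for C
  proof (intro set_eqI iffI)
    fix vs assume "vs \<in> {vs. length vs = k \<and> set vs \<subseteq> C \<and> indep_mod {0} vs}"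
    then have *: "length vs = k" "set vs \<subseteq> C" "dim (set vs) = k" "indep_mod {0} vs"
      by (auto simp: indep_mod_def dim0)
    have C: "subspace C" "dim C = k" using that by (auto simp: K_def)
    have "span (set vs) = C"
      using * C by (intro subspace_dim_equal) (auto simp: span_minimal)
    then show "vs \<in> {vs \<in> L. span (set vs) = C}" using * by (simp add: L_def)
  qed (auto simp: L_def intro: span_base)
  have "(\<Prod>i<k. q ^ dim (UNIV :: 'b set) - q ^ i) = real (card L)"
    using card_indep_mod[OF subspace_UNIV subspace_single_0, of k] by (simp add: q_def L_def)
  also have "\<dots> = (\<Sum>C\<in>K. real (card {vs \<in> L. span (set vs) = C}))"
    using sum.group[OF fin, of K "\<lambda>vs. span (set vs)" "\<lambda>_. 1 :: real"] LK
    by (simp add: image_subset_iff)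
  also have "\<dots> = (\<Sum>C\<in>K. \<Prod>i<k. q ^ k - q ^ i)"
  proof (rule sum.cong[OF refl])
    fix C assume C: "C \<in> K"
    then have "subspace C" "dim C = k" by (auto simp: K_def)
    then show "real (card {vs \<in> L. span (set vs) = C}) = (\<Prod>i<k. q ^ k - q ^ i)"
      using card_indep_mod[OF \<open>subspace C\<close> subspace_single_0, of k]
      by (simp add: fib[OF C] q_def subspace_0)
  qed
  finally have "real (card K) * (\<Prod>i<k. q ^ k - q ^ i) = (\<Prod>i<k. q ^ dim (UNIV :: 'b set) - q ^ i)"
    by simp
  moreover have "(\<Prod>i<k. q ^ k - q ^ i) \<noteq> 0"
    using q by (simp add: power_inject_exp)
  ultimately show ?thesis
    by (simp add: qbinom_def prod_dividef K_def q_def field_simps)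
qed

section \<open>Common complements of two subspaces\<close>

lemma set_map2_plus_subset:
  assumes "subspace T" "set ps \<subseteq> T" "set ys \<subseteq> T"
  shows "set (map2 (+) ps ys) \<subseteq> T"
  using assms by (fastforce simp: subspace_add dest: set_zip_leftD set_zip_rightD)

lemma span_Un_map2_plus:
  assumes "length ps = length ys" "set ys \<subseteq> span W"
  shows "span (W \<union> set (map2 (+) ps ys)) = span (W \<union> set ps)"
  using assms
proof (induction ps ys rule: list_induct2)
  case (Cons p ps y ys)
  have IH: "span (W \<union> set (map2 (+) ps ys)) = span (W \<union> set ps)"
    using Cons by simp
  have y: "y \<in> span (W \<union> set ps)"
    using Cons.prems span_mono[of W "W \<union> set ps"] by auto
  have "x - scale c (p + y) \<in> span (W \<union> set ps) \<longleftrightarrow> x - scale c p \<in> span (W \<union> set ps)" for x c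
  proof -
    have "x - scale c p = (x - scale c (p + y)) + scale c y"
      by (simp add: algebra_simps scale_right_distrib)
    then show ?thesis
      using y by (metis add_diff_cancel_right' span_add span_diff span_scale)
  qed
  then show ?case
    using IH by (simp add: span_insert)
qed simp

lemma indep_mod_append:
  "indep_mod W (rs @ qs) \<longleftrightarrow> indep_mod W qs \<and> indep_mod (W \<union> set qs) rs"
  by (induction rs) (auto simp: indep_mod_Cons Un_ac)

lemma indep_mod_span [simp]: "indep_mod (span W) vs \<longleftrightarrow> indep_mod W vs"
proof -
  have "span (span W \<union> set vs) = span (W \<union> set vs)"
    unfolding span_eq
    by (auto intro: span_base span_mono[THEN subsetD, rotated])
  then show ?thesis
    by (metis indep_mod_def dim_span)
qed

text \<open>
  Shifts of vectors that are independent modulo \<open>W + W'\<close> impose no condition, and shifting a vector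
  of \<open>W\<close> does not matter modulo \<open>W\<close>.
\<close>

lemma card_indep_mod_shifts:
  assumes W: "subspace W" and W': "subspace W'"
    and qs: "set qs \<subseteq> W" and rs: "indep_mod (W \<union> W') rs"
  shows "card {ys. length ys = length (rs @ qs) \<and> set ys \<subseteq> W' \<and> indep_mod W (map2 (+) (rs @ qs) ys)}
    = card W' ^ length rs * card {ys. length ys = length qs \<and> set ys \<subseteq> W' \<and> indep_mod W ys}"
  using rs
proof (induction rs)
  case Nil
  have "indep_mod W (map2 (+) qs ys) \<longleftrightarrow> indep_mod W ys"
    if "length ys = length qs" for ys
  proof (rule indep_mod_cong_span)
    have "map2 (+) qs ys = map2 (+) ys qs"
      using that by (simp add: list_eq_iff_nth_eq add.commute)
    then show "span (W \<union> set (map2 (+) qs ys)) = span (W \<union> set ys)"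
      using span_Un_map2_plus[of ys qs W] that qs by (auto intro: span_base)
  qed (use that in simp)
  then show ?case by (auto intro!: arg_cong[of _ _ card])
next
  case (Cons r rs)
  define Y where
    "Y rs = {ys. length ys = length (rs @ qs) \<and> set ys \<subseteq> W' \<and> indep_mod W (map2 (+) (rs @ qs) ys)}" for rs
  have rs: "indep_mod (W \<union> W') rs" and r: "r \<notin> span (W \<union> W' \<union> set rs)"
    using Cons.prems by (auto simp: indep_mod_Cons)
  \<comment> \<open>\<open>y\<close> and the shifted vectors lie in the span of \<open>W\<close>, \<open>W'\<close> and \<open>rs\<close>, and \<open>r\<close> does not.\<close>
  have free: "r + y \<notin> span (W \<union> set (map2 (+) (rs @ qs) ys))"
    if y: "y \<in> W'" and ys: "set ys \<subseteq> W'" for y ys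
  proof
    define T where "T = span (W \<union> W' \<union> set rs)"
    assume "r + y \<in> span (W \<union> set (map2 (+) (rs @ qs) ys))"
    moreover have "span (W \<union> set (map2 (+) (rs @ qs) ys)) \<subseteq> T"
    proof (rule span_minimal)
      have "set (rs @ qs) \<subseteq> T" "set ys \<subseteq> T"
        using qs ys by (auto simp: T_def intro: span_base)
      then have "set (map2 (+) (rs @ qs) ys) \<subseteq> T"
        by (intro set_map2_plus_subset) (auto simp: T_def)
      then show "W \<union> set (map2 (+) (rs @ qs) ys) \<subseteq> T"
        by (auto simp: T_def intro: span_base)
    qed (simp add: T_def)
    moreover have "y \<in> T" using y by (auto simp: T_def intro: span_base)
    ultimately have "r \<in> T"
      unfolding T_def by (metis add_diff_cancel_right' span_diff subsetD)
    then show False using r by (simp add: T_def)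
  qed
  have "Y (r # rs) = (\<lambda>(y, ys). y # ys) ` (W' \<times> Y rs)"
    using free by (force simp: Y_def indep_mod_Cons length_Suc_conv image_iff)
  then have "card (Y (r # rs)) = card W' * card (Y rs)"
    by (simp add: card_image inj_on_def card_cartesian_product)
  then show ?case
    using Cons.IH[OF rs] by (simp add: Y_def)
qed

lemma exists_indep_mod:
  assumes S: "subspace S" and W: "subspace W" and k: "dim (S \<inter> W) + k \<le> dim S"
  obtains vs where "length vs = k" "set vs \<subseteq> S" "indep_mod W vs"
proof -
  have "real CARD('a) ^ dim S - real CARD('a) ^ (dim (S \<inter> W) + i) > 0" if "i < k" for i
    using that k card_field_ge_2[where 'a = 'a] by (simp add: power_strict_increasing)
  then have "0 < (\<Prod>i<k. real CARD('a) ^ dim S - real CARD('a) ^ (dim (S \<inter> W) + i))"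
    by (intro prod_pos) auto
  then have "{vs. length vs = k \<and> set vs \<subseteq> S \<and> indep_mod W vs} \<noteq> {}"
    unfolding card_indep_mod[OF S W, symmetric] by (intro notI) simp
  then show thesis using that by auto
qed

text \<open>
  The common complements of \<open>W\<close> and \<open>W'\<close>, parametrised by the components in \<open>W'\<close> of the fixed vectors
  \<open>ps\<close>, which form a basis of one complement of \<open>W'\<close>. The dimension of \<open>W\<close> plays no role here:
  \<open>C \<inter> W = {0}\<close> is all that is asked.
\<close>

lemma bij_betw_complements:
  assumes W: "subspace W" and W': "subspace W'" and ps: "indep_mod W' ps"
    and k: "dim W' + length ps = dim (UNIV :: 'b set)"
  shows "bij_betw (\<lambda>ys. span (set (map2 (+) ps ys)))
    {ys. length ys = length ps \<and> set ys \<subseteq> W' \<and> indep_mod W (map2 (+) ps ys)}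
    {C. subspace C \<and> dim C = length ps \<and> C \<inter> W = {0} \<and> C \<inter> W' = {0}}"
    (is "bij_betw ?f ?Y ?K")
proof -
  have ind: "indep_mod W' (map2 (+) ps ys)" if "length ys = length ps" "set ys \<subseteq> W'" for ys
  proof -
    have "span (W' \<union> set (map2 (+) ps ys)) = span (W' \<union> set ps)"
      using that by (intro span_Un_map2_plus) (auto intro: span_base)
    from indep_mod_cong_span[OF this] show ?thesis using ps that by simp
  qed
  have "inj_on ?f ?Y"
  proof (rule inj_onI)
    fix ys ys' assume ys: "ys \<in> ?Y" "ys' \<in> ?Y" and eq: "?f ys = ?f ys'"
    have int: "W' \<inter> ?f ys = {0}"
      using indep_mod_subspaceD(2)[OF W' ind] ys by auto
    show "ys = ys'"
    proof (rule nth_equalityI)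
      fix i assume i: "i < length ys"
      have "ps ! i + ys ! i \<in> ?f ys" "ps ! i + ys' ! i \<in> ?f ys'"
        using i ys by (auto intro!: span_base simp: set_zip image_iff)
      then have "(ps ! i + ys ! i) - (ps ! i + ys' ! i) \<in> ?f ys"
        unfolding eq by (rule span_diff)
      then have "ys ! i - ys' ! i \<in> ?f ys" by simp
      moreover have "ys ! i - ys' ! i \<in> W'"
        using i ys W' by (auto intro!: subspace_diff simp: subset_iff)
      ultimately have "ys ! i - ys' ! i \<in> {0}" unfolding int[symmetric] by (rule IntI[rotated])
      then show "ys ! i = ys' ! i" by simp
    qed (use ys in auto)
  qed
  moreover have "?f ` ?Y = ?K"
  proof (intro set_eqI iffI)
    fix C assume "C \<in> ?f ` ?Y"
    then obtain ys where ys: "ys \<in> ?Y" and C: "C = ?f ys" by blast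
    have "C \<inter> W = {0}" "C \<inter> W' = {0}" "dim C = length ps"
      using indep_mod_subspaceD[OF W' ind[of ys]] indep_mod_subspaceD[OF W, of "map2 (+) ps ys"] ys
      by (auto simp: C)
    then show "C \<in> ?K" by (simp add: C)
  next
    fix C assume C': "C \<in> ?K"
    then have C: "subspace C" "dim C = length ps" "C \<inter> W = {0}" "C \<inter> W' = {0}" by auto
    have "dim (C \<union> W') = dim (UNIV :: 'b set)"
      using dim_Un_Int[OF C(1) W'] C k by simp
    then have "span (C \<union> W') = UNIV"
      by (metis dim_eq_full dim_UNIV dimension_def)
    \<comment> \<open>\<open>C\<close> and \<open>W'\<close> span the space, so every vector can be shifted into \<open>C\<close> along \<open>W'\<close>.\<close>
    then have "\<exists>y\<in>W'. p + y \<in> C" for p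
    proof -
      assume "span (C \<union> W') = UNIV"
      then obtain c w where "p = c + w" "c \<in> C" "w \<in> W'"
        using C(1) W' by (auto simp: span_Un span_eq_iff[THEN iffD2] set_eq_iff) metis
      then show ?thesis
        using W' by (intro bexI[of _ "- w"]) (auto simp: subspace_neg)
    qed
    then obtain g where g: "\<And>p. g p \<in> W'" "\<And>p. p + g p \<in> C" by metis
    define ys where "ys = map g ps"
    have ys: "length ys = length ps" "set ys \<subseteq> W'" using g by (auto simp: ys_def)
    define cs where "cs = map2 (+) ps ys"
    have len: "length cs = length ps" using ys by (simp add: cs_def)
    have "cs = map (\<lambda>p. p + g p) ps"
      by (simp add: cs_def ys_def list_eq_iff_nth_eq)
    then have cs: "set cs \<subseteq> C" using g by auto
    have "dim (set cs) = length ps"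
      using indep_mod_subspaceD(1)[OF W' ind[OF ys]] ys by (simp add: cs_def)
    then have sp: "span (set cs) = C"
      using C cs by (intro subspace_dim_equal) (auto simp: span_minimal)
    have "span (W \<union> set cs) = span (W \<union> C)"
      unfolding span_eq sp[symmetric]
      by (auto intro: span_base span_mono[THEN subsetD, rotated])
    then have "dim (W \<union> set cs) = dim (W \<union> C)" by (metis dim_span)
    also have "\<dots> = dim W + length cs"
      using dim_Un_Int[OF W C(1)] C len by (simp add: Int_commute)
    finally have "indep_mod W cs" by (simp add: indep_mod_def)
    then show "C \<in> ?f ` ?Y"
      using ys sp by (intro image_eqI[of _ _ ys]) (auto simp: cs_def)
  qed
  ultimately show ?thesis by (simp add: bij_betw_def)
qed

text \<open>
  The first conclusion makes the truncated subtraction in the exponent exact.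
\<close>

lemma card_common_complements:
  assumes W: "subspace W" "dim W = w" and W': "subspace W'" "dim W' = w"
    and l: "dim (W \<inter> W') = l" and k: "w + k = dim (UNIV :: 'b set)"
  shows "w \<le> k + l"
    and "real (card {C. subspace C \<and> dim C = k \<and> C \<inter> W = {0} \<and> C \<inter> W' = {0}})
      = real CARD('a) ^ ((k + l - w) * w) * (\<Prod>i\<in>{l..<w}. real CARD('a) ^ w - real CARD('a) ^ i)"
proof -
  have dWW': "dim (W \<union> W') + l = 2 * w"
    using dim_Un_Int[OF W(1) W'(1)] W W' l by simp
  have "dim (W \<union> W') \<le> dim (UNIV :: 'b set)" by (rule dim_subset) simp
  with dWW' k show wkl: "w \<le> k + l" by simp
  have lw: "l \<le> w" using l W(2) dim_subset[of "W \<inter> W'" W] by auto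
  define r where "r = w - l"
  \<comment> \<open>\<open>qs\<close> extends \<open>W'\<close> to \<open>W + W'\<close> inside \<open>W\<close>, and \<open>rs\<close> extends \<open>W + W'\<close> to the whole space.\<close>
  obtain qs where qs: "length qs = r" "set qs \<subseteq> W" "indep_mod W' qs"
    using exists_indep_mod[OF W(1) W'(1), of r] l lw W by (auto simp: r_def)
  have "dim (UNIV \<inter> span (W \<union> W')) + (k - r) \<le> dim (UNIV :: 'b set)"
    using dWW' k wkl lw by (simp add: r_def del: dim_UNIV)
  then obtain rs where rs: "length rs = k - r" "indep_mod (W \<union> W') rs"
    using exists_indep_mod[OF subspace_UNIV subspace_span, of "W \<union> W'" "k - r"]
    by (auto simp del: dim_UNIV)
  define ps where "ps = rs @ qs"
  have lps: "length ps = k"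
    using rs qs wkl lw by (simp add: ps_def r_def)
  have "span (W' \<union> set qs) = span (W \<union> W')"
  proof (rule subspace_dim_equal)
    show "span (W' \<union> set qs) \<subseteq> span (W \<union> W')"
      using qs by (intro span_mono) auto
    show "dim (span (W \<union> W')) \<le> dim (span (W' \<union> set qs))"
      using qs dWW' W' lw by (simp add: indep_mod_def r_def)
  qed auto
  then have ps: "indep_mod W' ps"
    using qs rs by (metis indep_mod_append indep_mod_span ps_def)
  have "card {C. subspace C \<and> dim C = k \<and> C \<inter> W = {0} \<and> C \<inter> W' = {0}}
      = card {ys. length ys = length ps \<and> set ys \<subseteq> W' \<and> indep_mod W (map2 (+) ps ys)}"
    using bij_betw_same_card[OF bij_betw_complements[OF W(1) W'(1) ps]] k lps W'(2) by simp
  also have "\<dots> = card W' ^ (k - r) * card {ys. length ys = r \<and> set ys \<subseteq> W' \<and> indep_mod W ys}"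
    using card_indep_mod_shifts[OF W(1) W'(1) qs(2) rs(2)] qs rs by (simp add: ps_def)
  finally have "real (card {C. subspace C \<and> dim C = k \<and> C \<inter> W = {0} \<and> C \<inter> W' = {0}})
      = real CARD('a) ^ (w * (k - r)) * (\<Prod>i<r. real CARD('a) ^ w - real CARD('a) ^ (l + i))"
    using card_indep_mod[OF W'(1) W(1), of r] W' l
    by (simp add: card_subspace power_mult Int_commute)
  moreover have "(\<Prod>i<r. real CARD('a) ^ w - real CARD('a) ^ (l + i))
      = (\<Prod>i\<in>{l..<w}. real CARD('a) ^ w - real CARD('a) ^ i)"
    using lw by (intro prod.reindex_bij_witness[of _ "\<lambda>i. i - l" "\<lambda>i. l + i"]) (auto simp: r_def)
  moreover have "k - r = k + l - w" using lw wkl by (simp add: r_def)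
  ultimately show "real (card {C. subspace C \<and> dim C = k \<and> C \<inter> W = {0} \<and> C \<inter> W' = {0}})
      = real CARD('a) ^ ((k + l - w) * w) * (\<Prod>i\<in>{l..<w}. real CARD('a) ^ w - real CARD('a) ^ i)"
    by (simp add: mult.commute)
qed

lemma exists_superspace:
  assumes "subspace S" "dim S \<le> u" "u \<le> dim (UNIV :: 'b set)"
  obtains U where "subspace U" "dim U = u" "S \<subseteq> U"
proof -
  obtain vs where "length vs = u - dim S" "indep_mod S vs"
    using exists_indep_mod[OF subspace_UNIV assms(1), of "u - dim S"] assms
    by (auto simp del: dim_UNIV)
  then show thesis
    using assms by (intro that[of "span (S \<union> set vs)"]) (auto simp: indep_mod_def intro: span_base)
qed

text \<open>
  The value of \<open>nu\<close> is the number of \<open>k\<close>-dimensional subspaces that are complements of neither \<open>W\<close> nor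
  \<open>W'\<close>, by inclusion-exclusion.
\<close>

lemma card_non_complements_Int:
  assumes W: "subspace W" "dim W = w" and W': "subspace W'" "dim W' = w"
    and k: "w + k = dim (UNIV :: 'b set)"
  shows "real (card ({C. subspace C \<and> dim C = k \<and> C \<inter> W \<noteq> {0}}
      \<inter> {C. subspace C \<and> dim C = k \<and> C \<inter> W' \<noteq> {0}}))
    = nu CARD('a) (dim (UNIV :: 'b set)) k (dim (W \<inter> W'))"
proof -
  define K where "K = {C. subspace C \<and> dim C = k}"
  define G where "G X = {C \<in> K. C \<inter> X = {0}}" for X
  define q where "q = real CARD('a)"
  define l where "l = dim (W \<inter> W')"
  have GG: "G X \<inter> G Y = {C. subspace C \<and> dim C = k \<and> C \<inter> X = {0} \<and> C \<inter> Y = {0}}" for X Y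
    by (auto simp: G_def K_def)
  \<comment> \<open>The complements of a single subspace are the common complements of two equal ones.\<close>
  have G: "real (card (G X)) = q ^ (k * w)" if "subspace X" "dim X = w" for X
    using card_common_complements(2)[OF that that _ k, of w] GG[of X X] that
    by (simp add: q_def)
  have "{C. subspace C \<and> dim C = k \<and> C \<inter> W \<noteq> {0}} \<inter> {C. subspace C \<and> dim C = k \<and> C \<inter> W' \<noteq> {0}}
      = K - (G W \<union> G W')"
    by (auto simp: G_def K_def)
  moreover have "real (card (K - (G W \<union> G W'))) = real (card K) - real (card (G W \<union> G W'))"
    by (subst card_Diff_subset) (auto simp: G_def intro!: of_nat_diff card_mono)
  moreover have "real (card (G W)) + real (card (G W'))
      = real (card (G W \<union> G W')) + real (card (G W \<inter> G W'))"
    using card_Un_Int[of "G W" "G W'"] by (simp flip: of_nat_add)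
  moreover have "real (card (G W \<inter> G W'))
      = q ^ ((k + l - w) * w) * (\<Prod>i\<in>{l..<w}. q ^ w - q ^ i)"
    using card_common_complements(2)[OF W W' _ k, of l] by (simp add: GG q_def l_def)
  moreover have "q powi ((2 * int k - int (w + k) + int l) * (int (w + k) - int k))
      = q ^ ((k + l - w) * w)"
  proof -
    have "(2 * int k - int (w + k) + int l) * (int (w + k) - int k) = int ((k + l - w) * w)"
      using card_common_complements(1)[OF W W' _ k, of l] by (simp add: l_def of_nat_diff)
    then show ?thesis by (simp only: power_int_of_nat)
  qed
  ultimately show ?thesis
    using card_subspaces_of_dim[of k] k[symmetric] G[OF W] G[OF W']
    by (simp add: nu_def K_def q_def l_def del: dim_UNIV)
qed

end

section \<open>Column spaces of matrices\<close>

interpretation fvec: finite_vector_space "(*s) :: 'a::{field,finite} \<Rightarrow> 'a^'n \<Rightarrow> 'a^'n"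
  by unfold_locales

interpretation fmat: finite_vector_space "mscale :: 'a::{field,finite} \<Rightarrow> 'a^'m^'n \<Rightarrow> 'a^'m^'n"
  by unfold_locales

text \<open>
  Expanding the rows in a basis \<open>B\<close> of the row space writes every column as a combination of the
  \<open>card B\<close> vectors of coefficients \<open>c b\<close>. Unlike an argument by orthogonality, this works over any
  field.
\<close>

lemma dim_columns_le_dim_rows_field:
  fixes M :: "'a::field^'m^'n"
  shows "vec.dim (columns M) \<le> vec.dim (rows M)"
proof -
  obtain B where B: "B \<subseteq> rows M" "vec.independent B" "rows M \<subseteq> vec.span B" "card B = vec.dim (rows M)"
    using vec.basis_exists by blast
  have fin: "finite B" using B(2) by (rule vec.finiteI_independent)
  define c where "c b = (\<chi> i. vec.representation B (row i M) b)" for b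
  have col: "column j M = (\<Sum>b\<in>B. b $ j *s c b)" for j
  proof -
    have "M $ i $ j = (\<Sum>b\<in>B. b $ j *s c b) $ i" for i
    proof -
      have "row i M \<in> vec.span B" using B(3) by (auto simp: rows_def)
      then have "row i M = (\<Sum>b\<in>B. vec.representation B (row i M) b *s b)"
        using vec.sum_representation_eq[OF B(2) _ fin] by simp
      then have "row i M $ j = (\<Sum>b\<in>B. vec.representation B (row i M) b *s b) $ j"
        by simp
      then show ?thesis
        by (simp add: sum_component c_def mult.commute row_def)
    qed
    then show ?thesis by (simp add: vec_eq_iff column_def)
  qed
  have "column j M \<in> vec.span (c ` B)" for j
    unfolding col by (intro vec.span_sum vec.span_scale vec.span_base imageI)
  then have "columns M \<subseteq> vec.span (c ` B)"
    by (auto simp: columns_def)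
  then have "vec.dim (columns M) \<le> card (c ` B)"
    using fin by (intro vec.dim_le_card) auto
  also have "\<dots> \<le> card B" using fin by (rule card_image_le)
  finally show ?thesis using B(4) by simp
qed

lemma rank_eq_dim_columns: "rank M = vec.dim (columns M)"
  for M :: "'a::field^'m^'n"
  using dim_columns_le_dim_rows_field[of M] dim_columns_le_dim_rows_field[of "transpose M"]
  by (simp add: row_rank_def_gen rows_transpose columns_transpose)

text \<open>
  The matrices with all columns in \<open>U\<close>, written \<open>A(U)\<close> above: as linear maps, those with image in \<open>U\<close>.
\<close>

definition mats_into :: "('a::field^'n) set \<Rightarrow> ('a^'m^'n) set"
  where "mats_into U = {M. columns M \<subseteq> U}"

lemma mats_into_iff: "M \<in> mats_into U \<longleftrightarrow> (\<forall>j. column j M \<in> U)"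
  by (auto simp: mats_into_def columns_def)

lemma mats_into_Int: "mats_into U \<inter> mats_into U' = mats_into (U \<inter> U')"
  by (auto simp: mats_into_def)

lemma subspace_mats_into:
  fixes U :: "('a::field^'n) set"
  assumes "vec.subspace U"
  shows "mat.subspace (mats_into U :: ('a^'m^'n) set)"
proof -
  have "column j (0 :: 'a^'m^'n) = 0" "column j (M + M') = column j M + column j M'"
    "column j (mscale c M) = c *s column j M" for j c and M M' :: "'a^'m^'n"
    by (simp_all add: column_def mscale_def vec_eq_iff)
  then show ?thesis
    using assms by (auto simp: mat.subspace_def vec.subspace_def mats_into_iff)
qed

lemma dim_mats_into:
  fixes U :: "('a::{field,finite}^'n) set"
  assumes "vec.subspace U"
  shows "mat.dim (mats_into U :: ('a^'m^'n) set) = CARD('m) * vec.dim U"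
proof -
  have "bij_betw (\<lambda>(M :: 'a^'m^'n) j. column j M) (mats_into U) (PiE UNIV (\<lambda>_. U))"
    by (rule bij_betwI[of _ _ _ "\<lambda>f. \<chi> i j. f j $ i"])
      (auto simp: mats_into_iff column_def PiE_def Pi_iff vec_eq_iff fun_eq_iff)
  then have "card (mats_into U :: ('a^'m^'n) set) = card U ^ CARD('m)"
    by (simp add: bij_betw_same_card card_PiE)
  then have "CARD('a) ^ mat.dim (mats_into U :: ('a^'m^'n) set) = CARD('a) ^ (CARD('m) * vec.dim U)"
    using assms
    by (simp add: fmat.card_subspace[OF subspace_mats_into] fvec.card_subspace mult.commute flip: power_mult)
  then show ?thesis
    using card_field_ge_2[where 'a = 'a] by (simp add: power_inject_exp)
qed

lemma dim_UNIV_mat: "mat.dim (UNIV :: ('a::{field,finite}^'m^'n) set) = CARD('m) * CARD('n)"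
proof -
  have "mats_into UNIV = (UNIV :: ('a^'m^'n) set)" by (auto simp: mats_into_def)
  then show ?thesis
    using dim_mats_into[where 'm = 'm, OF vec.subspace_UNIV] vec_dim_card by metis
qed

lemma rank_le_iff_mats_into:
  fixes M :: "'a::{field,finite}^'m^'n"
  assumes "u \<le> CARD('n)"
  shows "rank M \<le> u \<longleftrightarrow> (\<exists>U. vec.subspace U \<and> vec.dim U = u \<and> M \<in> mats_into U)"
proof
  assume "rank M \<le> u"
  then obtain U where "vec.subspace U" "vec.dim U = u" "vec.span (columns M) \<subseteq> U"
    using fvec.exists_superspace[of "vec.span (columns M)" u] assms
    by (auto simp: rank_eq_dim_columns vec_dim_card simp del: fvec.dim_UNIV vec.dim_UNIV)
  then show "\<exists>U. vec.subspace U \<and> vec.dim U = u \<and> M \<in> mats_into U"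
    by (auto simp: mats_into_def intro: vec.span_base)
next
  assume "\<exists>U. vec.subspace U \<and> vec.dim U = u \<and> M \<in> mats_into U"
  then show "rank M \<le> u"
    by (auto simp: rank_eq_dim_columns mats_into_def intro: vec.dim_subset)
qed

lemma min_dist_ge_iff:
  fixes C :: "('a::{field,finite}^'m^'n) set"
  assumes "rank_metric_code C" and "Suc u \<le> CARD('n)"
  shows "Suc u \<le> min_dist C \<longleftrightarrow> (\<forall>U. vec.subspace U \<and> vec.dim U = u \<longrightarrow> C \<inter> mats_into U = {0})"
proof -
  have C: "0 \<in> C" "C \<noteq> {0}"
    using assms by (auto simp: rank_metric_code_def mat.subspace_0)
  have "finite {rank M | M. M \<in> C \<and> M \<noteq> 0}" "{rank M | M. M \<in> C \<and> M \<noteq> 0} \<noteq> {}"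
    using C by (auto simp: setcompr_eq_image)
  then have "Suc u \<le> min_dist C \<longleftrightarrow> (\<forall>M\<in>C. M \<noteq> 0 \<longrightarrow> \<not> rank M \<le> u)"
    by (auto simp: min_dist_def not_le Suc_le_eq)
  also have "\<dots> \<longleftrightarrow> (\<forall>U. vec.subspace U \<and> vec.dim U = u \<longrightarrow> C \<inter> mats_into U \<subseteq> {0})"
  proof -
    have "rank M \<le> u \<longleftrightarrow> (\<exists>U. vec.subspace U \<and> vec.dim U = u \<and> M \<in> mats_into U)" for M :: "'a^'m^'n"
      using assms by (intro rank_le_iff_mats_into) simp
    then show ?thesis by blast
  qed
  also have "\<dots> \<longleftrightarrow> (\<forall>U. vec.subspace U \<and> vec.dim U = u \<longrightarrow> C \<inter> mats_into U = {0})"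
    using C(1) by (auto simp: mat.subspace_0 subspace_mats_into)
  finally show ?thesis .
qed

section \<open>The density bound\<close>

text \<open>
  The Cauchy-Schwarz inequality for the function that counts in how many of the sets a point lies.
\<close>

lemma card_Union_Cauchy_Schwarz:
  assumes "finite I" and fin: "\<And>i. i \<in> I \<Longrightarrow> finite (B i)"
  shows "(\<Sum>i\<in>I. real (card (B i)))\<^sup>2
    \<le> real (card (\<Union>i\<in>I. B i)) * (\<Sum>i\<in>I. \<Sum>j\<in>I. real (card (B i \<inter> B j)))"
proof -
  define X where "X = (\<Union>i\<in>I. B i)"
  have X: "finite X" using assms by (simp add: X_def)
  have card: "real (card A) = (\<Sum>x\<in>X. of_bool (x \<in> A))" if "A \<subseteq> X" for A
    using X that by (simp add: Int_absorb1)
  define f :: "_ \<Rightarrow> real" where "f x = (\<Sum>i\<in>I. of_bool (x \<in> B i))" for x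
  have "(\<Sum>i\<in>I. real (card (B i))) = (\<Sum>i\<in>I. \<Sum>x\<in>X. of_bool (x \<in> B i))"
    by (intro sum.cong card) (auto simp: X_def)
  also have "\<dots> = (\<Sum>x\<in>X. 1 * f x)"
    unfolding f_def by (subst sum.swap) simp
  finally have "(\<Sum>i\<in>I. real (card (B i)))\<^sup>2 \<le> (\<Sum>x\<in>X. 1\<^sup>2) * (\<Sum>x\<in>X. (f x)\<^sup>2)"
    using Cauchy_Schwarz_ineq_sum[of "\<lambda>_. 1" f X] by simp
  also have "(\<Sum>x\<in>X. (f x)\<^sup>2) = (\<Sum>x\<in>X. \<Sum>i\<in>I. \<Sum>j\<in>I. of_bool (x \<in> B i \<inter> B j))"
    by (simp add: f_def power2_eq_square sum_product of_bool_conj)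
  also have "\<dots> = (\<Sum>i\<in>I. \<Sum>j\<in>I. \<Sum>x\<in>X. of_bool (x \<in> B i \<inter> B j))"
    by (subst sum.swap, intro sum.cong refl, subst sum.swap) simp
  also have "\<dots> = (\<Sum>i\<in>I. \<Sum>j\<in>I. real (card (B i \<inter> B j)))"
    by (intro sum.cong refl card[symmetric]) (auto simp: X_def)
  finally show ?thesis by (simp add: X_def)
qed

theorem theorem5p7:
  fixes q m n d k :: nat
  assumes "CARD('a::{field,finite}) = q"
    and "CARD('n::finite) = n"
    and "CARD('m::finite) = m"
    and "n \<le> m" and "2 \<le> n"
    and "2 \<le> d" and "d \<le> n"
    and "k = m * (n - d + 1)"
  shows "delta TYPE('a) TYPE('n) TYPE('m) k d \<le>
    1 - ((qbinom q n (d - 1))\<^sup>2 * (nu q (m * n) k (m * (d - 1)))\<^sup>2) /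
        (qbinom q (m * n) k *
          (\<Sum>i = 0..d - 1. nu q (m * n) k (m * i) * real (theta TYPE('a) TYPE('n) (d - 1) i)))"
proof -
  define u where "u = d - 1"
  have d: "d = Suc u" and u: "Suc u \<le> CARD('n)" using assms by (auto simp: u_def)
  define N where "N = m * n"
  have N: "mat.dim (UNIV :: ('a^'m^'n) set) = N"
    using assms by (simp add: dim_UNIV_mat N_def del: fmat.dim_UNIV)
  have "n = u + (n - d + 1)" using assms u by (simp add: d)
  then have k: "m * u + k = N"
    using assms by (metis N_def distrib_left)
  \<comment> \<open>A positive \<open>k\<close> makes every \<open>k\<close>-dimensional subspace a nonzero one, hence a code.\<close>
  have k0: "k > 0" using assms by simp
  define I where "I = {U :: ('a^'n) set. vec.subspace U \<and> vec.dim U = u}"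
  define K where "K = {C :: ('a^'m^'n) set. mat.subspace C \<and> mat.dim C = k}"
  define B where "B U = {C :: ('a^'m^'n) set. mat.subspace C \<and> mat.dim C = k \<and> C \<inter> mats_into U \<noteq> {0}}" for U
  have cardK: "real (card K) = qbinom q N k"
    unfolding K_def fmat.card_subspaces_of_dim N using assms by simp
  have cardI: "real (card I) = qbinom q n u"
    unfolding I_def fvec.card_subspaces_of_dim vec_dim_card using assms by simp
  have BB: "real (card (B U \<inter> B U')) = nu q N k (m * vec.dim (U \<inter> U'))"
    if "U \<in> I" "U' \<in> I" for U U'
  proof -
    have U: "vec.subspace U" "vec.dim U = u" "vec.subspace U'" "vec.dim U' = u"
      using that by (auto simp: I_def)
    have "real (card (B U \<inter> B U')) = nu CARD('a) (mat.dim (UNIV :: ('a^'m^'n) set)) k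
        (mat.dim (mats_into U \<inter> mats_into U' :: ('a^'m^'n) set))"
      unfolding B_def
    proof (rule fmat.card_non_complements_Int)
      show "m * u + k = mat.dim (UNIV :: ('a^'m^'n) set)" by (simp only: N k)
    qed (use U assms in \<open>simp_all add: subspace_mats_into dim_mats_into\<close>)
    then show ?thesis
      unfolding N using U assms
      by (simp add: mats_into_Int dim_mats_into vec.subspace_inter)
  qed
  have cardB: "real (card (B U)) = nu q N k (m * u)" if "U \<in> I" for U
    using BB[OF that that] that by (simp add: I_def)
  define D where "D = (\<Sum>U\<in>I. \<Sum>U'\<in>I. real (card (B U \<inter> B U')))"
  have D: "D = (\<Sum>i = 0..u. nu q N k (m * i) * real (theta TYPE('a) TYPE('n) u i))"
  proof -
    have "D = (\<Sum>(U, U')\<in>I \<times> I. real (card (B U \<inter> B U')))"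
      by (simp add: D_def sum.cartesian_product)
    also have "\<dots> = (\<Sum>p\<in>I \<times> I. nu q N k (m * vec.dim (fst p \<inter> snd p)))"
      by (intro sum.cong) (auto simp: BB)
    also have "\<dots> = (\<Sum>i = 0..u. \<Sum>p\<in>{p \<in> I \<times> I. vec.dim (fst p \<inter> snd p) = i}.
        nu q N k (m * vec.dim (fst p \<inter> snd p)))"
    proof (rule sum.group[symmetric])
      show "(\<lambda>p. vec.dim (fst p \<inter> snd p)) ` (I \<times> I) \<subseteq> {0..u}"
        using vec.dim_subset[OF Int_lower1] by (fastforce simp: I_def)
    qed auto
    also have "\<dots> = (\<Sum>i = 0..u. nu q N k (m * i) * real (theta TYPE('a) TYPE('n) u i))"
    proof (rule sum.cong[OF refl])
      fix i
      have "theta TYPE('a) TYPE('n) u i = card {p \<in> I \<times> I. vec.dim (fst p \<inter> snd p) = i}"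
        unfolding theta_def by (rule arg_cong[of _ _ card]) (auto simp: I_def)
      then show "(\<Sum>p\<in>{p \<in> I \<times> I. vec.dim (fst p \<inter> snd p) = i}. nu q N k (m * vec.dim (fst p \<inter> snd p)))
          = nu q N k (m * i) * real (theta TYPE('a) TYPE('n) u i)"
        by simp
    qed
    finally show ?thesis .
  qed
  define S where "S = qbinom q n u * nu q N k (m * u)"
  have "(\<Sum>U\<in>I. real (card (B U))) = S"
    by (simp add: cardB S_def cardI)
  then have CS: "S\<^sup>2 \<le> real (card (\<Union>U\<in>I. B U)) * D"
    using card_Union_Cauchy_Schwarz[of I B] by (simp add: D_def)
  have "D \<ge> 0" by (simp add: D_def sum_nonneg)
  have good: "{C :: ('a^'m^'n) set. rank_metric_code C \<and> mat.dim C = k \<and> min_dist C \<ge> d}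
      = K - (\<Union>U\<in>I. B U)"
  proof -
    have "rank_metric_code C \<longleftrightarrow> mat.subspace C" if "mat.dim C = k" for C :: "('a^'m^'n) set"
      using that k0 by (auto simp: rank_metric_code_def)
    then show ?thesis
      using min_dist_ge_iff[OF _ u] by (auto simp: K_def I_def B_def d)
  qed
  have "real (card (K - (\<Union>U\<in>I. B U))) = real (card K) - real (card (\<Union>U\<in>I. B U))"
    by (subst card_Diff_subset) (auto simp: B_def K_def intro!: of_nat_diff card_mono)
  then have delta: "delta TYPE('a) TYPE('n) TYPE('m) k d
      = (real (card K) - real (card (\<Union>U\<in>I. B U))) / real (card K)"
    unfolding delta_def good cardK using assms by (simp add: N_def)
  have "card K \<noteq> 0"
  proof -
    have "k \<le> mat.dim (UNIV :: ('a^'m^'n) set)" using k N by linarith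
    then obtain C :: "('a^'m^'n) set" where "mat.subspace C" "mat.dim C = k"
      using fmat.exists_superspace[OF mat.subspace_single_0, of k] by auto
    then show ?thesis by (auto simp: K_def)
  qed
  then have K0: "real (card K) > 0" by linarith
  \<comment> \<open>If \<open>D = 0\<close>, the quotient is \<open>0\<close> by convention and the bound is trivial.\<close>
  have "S\<^sup>2 / D \<le> real (card (\<Union>U\<in>I. B U))"
    using CS \<open>D \<ge> 0\<close> by (cases "D = 0") (auto simp: divide_le_eq)
  then have "S\<^sup>2 / D / real (card K) \<le> real (card (\<Union>U\<in>I. B U)) / real (card K)"
    using K0 by (intro divide_right_mono) auto
  then have "delta TYPE('a) TYPE('n) TYPE('m) k d \<le> 1 - S\<^sup>2 / (real (card K) * D)"
    using K0 by (simp add: delta diff_divide_distrib mult.commute)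
  then show ?thesis
    by (simp add: cardK D S_def power_mult_distrib u_def N_def)
qed

end
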